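(* Let the input distribution be uniform on $\{0,1\}^d$. Let $\mathcal{M}$ be any feasible meta-algorithm that fixes monotonicity with query complexity $q=2^{o(d)}$. Then there exists an input function $f:\{0,1\}^d\to\{0,1\}$ with $\mathbb{E}[f(x)]\ge 1-2^{-\Omega(d)}$ such that $\mathbb{E}[\mathcal{M}_f(x)]\le 2^{-\Omega(d)}$. Moreover, if the meta-algorithm (with query complexity $q=2^{o(d)}$) is infeasible or non-monotone with probability $\delta$, then there exists such an input function $f$ (i.e. with $\mathbb{E}[f(x)]\ge 1-2^{-\Omega(d)}$) for which $\mathbb{E}[\mathcal{M}_f(x)]\le 2\delta+2^{-\Omega(d)}$.
   Context: For $x,y\in\{0,1\}^d$, $x\le y$ means $x_i\le y_i$ for all $i$. Expectations are over $x$ uniform on $\{0,1\}^d$ and, for $\mathcal{M}_f(x)$, also over the internal randomness of the meta-algorithm. Meta-algorithm: a (possibly randomized) procedure, one for each dimension $d$, with a random seed that is independent of the input and shared by all inputs; given oracle access to a function $f:\{0,1\}^d\to\{0,1\}$, on an input $x\in\{0,1\}^d$ it adaptively queries $f$ at points of its choice and outputs a number $\mathcal{M}_f(x)\in[0,1]$. It fixes monotonicity if, for every $f$, $x\le y$ implies $\mathcal{M}_f(x)\le\mathcal{M}_f(y)$. It is feasible if, for every $f$ and $x$, $\mathcal{M}_f(x)\le\max_{y\le x}f(y)$. "Infeasible or non-monotone with probability $\delta$" means that for every $f$, with probability at least $1-\delta$ over the internal randomness, the function $\mathcal{M}_f$ is both monotone and feasible. Query complexity $q=q(d)$: the maximum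 number of oracle calls to $f$ made in order to answer a single input $x$. Asymptotic notation is as $d\to\infty$; $2^{-\Omega(d)}$ denotes a quantity at most $2^{-cd}$ for some constant $c>0$ and all sufficiently large $d$. *)

theory Defs
  imports "HOL-Probability.Probability" "HOL-Library.Landau_Symbols" "HOL-Library.Extended_Nat"
begin

type_synonym point = "bool list"

definition cube :: "nat \<Rightarrow> point set" where
  "cube d = {x. length x = d}"

definition cube_le :: "point \<Rightarrow> point \<Rightarrow> bool" where
  "cube_le x y \<longleftrightarrow> list_all2 (\<le>) x y"

text \<open>
  A deterministic adaptive query procedure is a decision tree: either it stops with a number,
  or it queries a point and continues according to the answer bit.
\<close>

datatype query_tree = Output real | Query point "bool \<Rightarrow> query_tree"

primrec result :: "query_tree \<Rightarrow> (point \<Rightarrow> bool) \<Rightarrow> real" where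
  "result (Output r) f = r"
| "result (Query x k) f = result (k (f x)) f"

primrec calls :: "query_tree \<Rightarrow> (point \<Rightarrow> bool) \<Rightarrow> point list" where
  "calls (Output r) f = []"
| "calls (Query x k) f = x # calls (k (f x)) f"

text \<open>
  In dimension \<open>d\<close> the seed is drawn from the probability space \<open>S d\<close>; once the seed \<open>s\<close> and the
  input \<open>x\<close> are fixed, \<open>A d s x\<close> is the decision tree that is run against the oracle. As the same
  \<open>s\<close> is used for all inputs \<open>x\<close>, the seed is shared between them.

  Oracles are total functions on lists, but all calls are required to stay inside \<open>cube d\<close>, so
  only the restriction of an oracle to \<open>cube d\<close> matters.
\<close>

type_synonym 's algorithm = "nat \<Rightarrow> 's \<Rightarrow> point \<Rightarrow> query_tree"

definition meta_algorithm :: "(nat \<Rightarrow> 's measure) \<Rightarrow> 's algorithm \<Rightarrow> bool" where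
  "meta_algorithm S A \<longleftrightarrow>
     (\<forall>d. prob_space (S d)) \<and>
     (\<forall>d. \<forall>s\<in>space (S d). \<forall>x\<in>cube d. \<forall>f.
        set (calls (A d s x) f) \<subseteq> cube d \<and> result (A d s x) f \<in> {0..1}) \<and>
     (\<forall>d. \<forall>x\<in>cube d. \<forall>f. (\<lambda>s. result (A d s x) f) \<in> borel_measurable (S d))"

definition query_complexity :: "(nat \<Rightarrow> 's measure) \<Rightarrow> 's algorithm \<Rightarrow> nat \<Rightarrow> enat" where
  "query_complexity S A d =
     (SUP s\<in>space (S d). SUP x\<in>cube d. SUP f. enat (length (calls (A d s x) f)))"

text \<open>\<open>q = 2\<^sup>o\<^sup>(\<^sup>d\<^sup>)\<close>, read as an upper bound (so that \<open>q d = 0\<close> is allowed)\<close>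

definition subexponential :: "(nat \<Rightarrow> nat) \<Rightarrow> bool" where
  "subexponential q \<longleftrightarrow>
     (\<exists>e\<in>o(\<lambda>d. real d). \<forall>\<^sub>F d in sequentially. real (q d) \<le> 2 powr e d)"

text \<open>\<open>g \<le> 2\<^sup>-\<^sup>\<Omega>\<^sup>(\<^sup>d\<^sup>)\<close>\<close>

definition exp_small :: "(nat \<Rightarrow> real) \<Rightarrow> bool" where
  "exp_small g \<longleftrightarrow> (\<exists>c>0. \<forall>\<^sub>F d in sequentially. g d \<le> 2 powr (- c * real d))"

definition cube_mono :: "nat \<Rightarrow> (point \<Rightarrow> real) \<Rightarrow> bool" where
  "cube_mono d g \<longleftrightarrow> (\<forall>x\<in>cube d. \<forall>y\<in>cube d. cube_le x y \<longrightarrow> g x \<le> g y)"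

definition cube_feasible :: "nat \<Rightarrow> (point \<Rightarrow> bool) \<Rightarrow> (point \<Rightarrow> real) \<Rightarrow> bool" where
  "cube_feasible d f g \<longleftrightarrow>
     (\<forall>x\<in>cube d. g x \<le> Max ((\<lambda>y. of_bool (f y)) ` {y \<in> cube d. cube_le y x}))"

definition fixes_monotonicity :: "(nat \<Rightarrow> 's measure) \<Rightarrow> 's algorithm \<Rightarrow> bool" where
  "fixes_monotonicity S A \<longleftrightarrow>
     (\<forall>d. \<forall>s\<in>space (S d). \<forall>f. cube_mono d (\<lambda>x. result (A d s x) f))"

definition feasible :: "(nat \<Rightarrow> 's measure) \<Rightarrow> 's algorithm \<Rightarrow> bool" where
  "feasible S A \<longleftrightarrow>
     (\<forall>d. \<forall>s\<in>space (S d). \<forall>f. cube_feasible d f (\<lambda>x. result (A d s x) f))"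

text \<open>Infeasible or non-monotone with probability \<open>\<delta>\<close>, which may depend on the dimension\<close>

definition infeasible_or_nonmono_with_prob ::
    "(nat \<Rightarrow> 's measure) \<Rightarrow> 's algorithm \<Rightarrow> (nat \<Rightarrow> real) \<Rightarrow> bool" where
  "infeasible_or_nonmono_with_prob S A \<delta> \<longleftrightarrow>
     (\<forall>d f. measure (S d) {s \<in> space (S d).
          cube_mono d (\<lambda>x. result (A d s x) f) \<and>
          cube_feasible d f (\<lambda>x. result (A d s x) f)} \<ge> 1 - \<delta> d)"

definition expect_input :: "nat \<Rightarrow> (point \<Rightarrow> bool) \<Rightarrow> real" where
  "expect_input d f = (\<integral>x. of_bool (f x) \<partial>uniform_count_measure (cube d))"

text \<open>The product measure expresses that the input and the seed are independent.\<close>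

definition expect_output ::
    "(nat \<Rightarrow> 's measure) \<Rightarrow> 's algorithm \<Rightarrow> nat \<Rightarrow> (point \<Rightarrow> bool) \<Rightarrow> real" where
  "expect_output S A d f =
     (\<integral>(x, s). result (A d s x) f \<partial>(uniform_count_measure (cube d) \<Otimes>\<^sub>M S d))"

end

theory Submission
  imports Defs
begin

text \<open>
  One function \<open>F\<close> defeats every algorithm: the indicator of weight at least \<open>31d/64\<close>. Take \<open>x\<close> and
  \<open>w\<close> uniform and \<open>z = x \<or> w\<close>. Let \<open>G\<close> be \<open>F\<close> set to 0 everywhere below \<open>z\<close>, and \<open>H\<close> be \<open>F\<close> set
  to 0 only at those points below \<open>z\<close> that have Hamming distance more than \<open>d/16\<close> from \<open>x\<close>.

  On input \<open>x\<close>, telling \<open>F\<close> from \<open>H\<close> takes a query of some \<open>y \<le> z\<close> that is far from \<open>x\<close> but not of low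
  weight; such a \<open>y\<close> has linearly many ones outside \<open>x\<close>, all of which \<open>w\<close> would have to hit. On input
  \<open>z\<close>, telling \<open>G\<close> from \<open>H\<close> takes a query close to \<open>x\<close>, but \<open>z\<close> leaves too many candidates for \<open>x\<close>.
  So, up to an exponentially small error, the output at \<open>x\<close> on \<open>F\<close> is the output at \<open>x\<close> on \<open>H\<close>, which
  by monotonicity is at most the output at \<open>z\<close> on \<open>H\<close>, which is the output at \<open>z\<close> on \<open>G\<close>, which by
  feasibility is 0. Correctness is used for the two functions \<open>G\<close> and \<open>H\<close>, whence \<open>2\<delta>\<close>.
\<close>

section \<open>Weight, Hamming distance and join on the cube\<close>

definition wt :: "point \<Rightarrow> nat" where
  "wt x = count_list x True"

definition excess :: "point \<Rightarrow> point \<Rightarrow> nat" where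
  "excess x y = length (filter (\<lambda>(a, b). a \<and> \<not> b) (zip x y))"

definition hdist :: "point \<Rightarrow> point \<Rightarrow> nat" where
  "hdist x y = excess x y + excess y x"

definition join :: "point \<Rightarrow> point \<Rightarrow> point" where
  "join x y = map2 (\<or>) x y"

lemma wt_simps [simp]: "wt [] = 0" "wt (a # x) = of_bool a + wt x"
  by (auto simp: wt_def)

lemma excess_simps [simp]:
  "excess [] y = 0" "excess (a # x) (b # y) = of_bool (a \<and> \<not> b) + excess x y"
  by (auto simp: excess_def)

lemma hdist_simps [simp]:
  "hdist [] [] = 0" "hdist (a # x) (b # y) = of_bool (a \<noteq> b) + hdist x y"
  by (auto simp: hdist_def)

lemma join_simps [simp]: "join [] y = []" "join (a # x) (b # y) = (a \<or> b) # join x y"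
  by (auto simp: join_def)

lemma cube_0 [simp]: "cube 0 = {[]}"
  by (auto simp: cube_def)

lemma cube_Suc: "cube (Suc d) = (#) True ` cube d \<union> (#) False ` cube d"
proof -
  have "x \<in> (#) True ` cube d \<union> (#) False ` cube d" if "x \<in> cube (Suc d)" for x
    using that by (cases x; cases "hd x") (auto simp: cube_def)
  then show ?thesis by (auto simp: cube_def)
qed

lemma finite_cube [simp]: "finite (cube d)"
  by (induction d) (auto simp: cube_Suc)

lemma sum_cube_Suc:
  "(\<Sum>x\<in>cube (Suc d). g x) = (\<Sum>x\<in>cube d. g (True # x)) + (\<Sum>x\<in>cube d. g (False # x))"
proof -
  have "(\<Sum>x\<in>cube (Suc d). g x) = sum g ((#) True ` cube d) + sum g ((#) False ` cube d)"
    unfolding cube_Suc by (rule sum.union_disjoint) auto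
  then show ?thesis by (simp add: sum.reindex)
qed

lemma card_cube: "card (cube d) = 2 ^ d"
proof -
  have "(\<Sum>x\<in>cube d. 1 :: nat) = 2 ^ d"
    by (induction d) (simp_all only: sum_cube_Suc, simp_all)
  then show ?thesis by simp
qed

lemma cube_nonempty [simp]: "cube d \<noteq> {}"
  using card_cube[of d] by (metis card.empty power_not_zero zero_neq_numeral)

lemma join_in_cube: "x \<in> cube d \<Longrightarrow> y \<in> cube d \<Longrightarrow> join x y \<in> cube d"
  by (simp add: cube_def join_def)

lemma cube_le_join: "x \<in> cube d \<Longrightarrow> y \<in> cube d \<Longrightarrow> cube_le x (join x y)"
  by (auto simp: cube_def cube_le_def join_def list_all2_conv_all_nth)

text \<open>Both sides are the weight of the join of \<open>x\<close> and \<open>y\<close>.\<close>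

lemma excess_wt: "length x = length y \<Longrightarrow> excess x y + wt y = excess y x + wt x"
  by (induction x y rule: list_induct2) auto

lemma hdist_False: "length x = d \<Longrightarrow> hdist (replicate d False) x = wt x"
  by (induction x arbitrary: d) auto

lemma hdist_True: "length x = d \<Longrightarrow> hdist (replicate d True) x + wt x = d"
  by (induction x arbitrary: d) auto

text \<open>The two excesses add up to more than \<open>4d/64\<close>, and by
  \<open>excess_wt\<close> that of \<open>x\<close> over \<open>y\<close> is at most
  \<open>2d/64\<close> larger than that of \<open>y\<close> over \<open>x\<close>. Here the
  thresholds 31/64, 33/64 and 1/16 have to fit together.\<close>

lemma excess_ge_of_far:
  assumes "x \<in> cube d" "y \<in> cube d" "64 * wt x \<le> 33 * d" "31 * d \<le> 64 * wt y" "d < 16 * hdist x y"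
  shows "d \<le> 64 * excess y x"
  using assms excess_wt[of x y] by (simp add: cube_def hdist_def)

section \<open>Counting: balls, covers and fibres of the join\<close>

lemma sum_power_hdist:
  fixes a :: real
  assumes "x \<in> cube d"
  shows "(\<Sum>y\<in>cube d. a ^ hdist x y) = (1 + a) ^ d"
  using assms
proof (induction d arbitrary: x)
  case (Suc d)
  then obtain b x' where x: "x = b # x'" "x' \<in> cube d"
    by (auto simp: cube_Suc)
  then show ?case
    using Suc.IH[of x'] by (cases b) (simp_all add: sum_cube_Suc sum_distrib_left [symmetric] algebra_simps)
qed auto

text \<open>Chernoff's method: since \<open>a \<le> 1\<close>, each point of the ball contributes at
  least \<open>a powr r\<close> to the generating function of the distance, in which every
  coordinate gives a factor \<open>1 + a\<close>.\<close>

lemma card_ball_le: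
  fixes a r :: real
  assumes "x \<in> cube d" "0 < a" "a \<le> 1"
  shows "real (card {y \<in> cube d. real (hdist x y) \<le> r}) \<le> (1 + a) ^ d / a powr r"
proof -
  have "real (card {y \<in> cube d. real (hdist x y) \<le> r}) * a powr r
      = (\<Sum>y | y \<in> cube d \<and> real (hdist x y) \<le> r. a powr r)"
    by simp
  also have "\<dots> \<le> (\<Sum>y | y \<in> cube d \<and> real (hdist x y) \<le> r. a ^ hdist x y)"
    using assms by (intro sum_mono) (auto simp: powr_realpow [symmetric] intro: powr_mono')
  also have "\<dots> \<le> (\<Sum>y\<in>cube d. a ^ hdist x y)"
    using assms by (intro sum_mono2) auto
  also have "\<dots> = (1 + a) ^ d"
    using assms by (intro sum_power_hdist)
  finally show ?thesis
    using assms by (simp add: field_simps)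
qed

text \<open>Exactly the coordinates at which \<open>y\<close> is 1 and \<open>x\<close> is 0 force a
  bit of \<open>w\<close>; the other bits are free. The product form avoids a truncated difference
  of exponents.\<close>

lemma card_cover:
  assumes "x \<in> cube d" "y \<in> cube d"
  shows "(\<Sum>w\<in>cube d. of_bool (cube_le y (join x w)) :: real) * 2 ^ excess y x = 2 ^ d"
  using assms
proof (induction d arbitrary: x y)
  case (Suc d)
  from Suc.prems obtain b x' c y' where "x = b # x'" "x' \<in> cube d" "y = c # y'" "y' \<in> cube d"
    by (auto simp: cube_Suc)
  then show ?case
    using Suc.IH[of x' y'] by (cases b; cases c) (simp_all add: sum_cube_Suc cube_le_def algebra_simps)
qed (auto simp: cube_le_def)

text \<open>If \<open>join x w = z\<close>, then \<open>w\<close> agrees with \<open>z\<close>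
  wherever \<open>x\<close> is 0, so only the bits at the ones of \<open>x\<close> are free.\<close>

lemma card_join_fibre:
  assumes "x \<in> cube d" "z \<in> cube d"
  shows "(\<Sum>w\<in>cube d. of_bool (join x w = z) :: real) \<le> 2 ^ wt x"
  using assms
proof (induction d arbitrary: x z)
  case (Suc d)
  from Suc.prems obtain b x' c z' where "x = b # x'" "x' \<in> cube d" "z = c # z'" "z' \<in> cube d"
    by (auto simp: cube_Suc)
  then show ?case
    using Suc.IH[of x' z'] by (cases b; cases c) (simp_all add: sum_cube_Suc)
qed auto

lemma result_cong: "(\<And>y. y \<in> set (calls t f) \<Longrightarrow> f y = g y) \<Longrightarrow> result t f = result t g"
  by (induction t) auto

text \<open>
  The exponent that the generating function bound gives for the ball of radius \<open>31d/64\<close> at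
  \<open>a = 15/16\<close>, relative to \<open>2\<^sup>d\<close>.
\<close>

definition tail_rate :: real where
  "tail_rate = - log 2 ((31 / 32) * (16 / 15) powr (31 / 64))"

text \<open>The 64th power removes the fractional exponent and leaves a comparison of rational
  numbers.\<close>

lemma tail_rate_pos: "tail_rate > 0"
proof -
  define c :: real where "c = (31 / 32) * (16 / 15) powr (31 / 64)"
  have "c ^ 64 = (31 / 32) ^ 64 * ((16 / 15) powr (31 / 64)) ^ 64"
    unfolding c_def by (rule power_mult_distrib)
  also have "((16 / 15 :: real) powr (31 / 64)) ^ 64 = (16 / 15) ^ 31"
    by (subst powr_power) auto
  also have "(31 / 32 :: real) ^ 64 * (16 / 15) ^ 31 < 1" by (simp add: power_divide)
  finally have "c ^ 64 < 1" .
  then have "c < 1"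
    by (meson not_less one_le_power)
  moreover have "c > 0" by (simp add: c_def)
  ultimately have "log 2 c < 0"
    by simp
  then show ?thesis
    by (simp only: tail_rate_def c_def neg_0_less_iff_less)
qed

text \<open>The centre is arbitrary so that the all-ones and the all-zeros point give the upper and
  the lower tail of the weight.\<close>

lemma card_tail_le:
  assumes "x \<in> cube d"
  shows "real (card {y \<in> cube d. 64 * hdist x y \<le> 31 * d}) \<le> 2 ^ d * 2 powr (- tail_rate * d)"
proof -
  have "{y \<in> cube d. 64 * hdist x y \<le> 31 * d} = {y \<in> cube d. real (hdist x y) \<le> 31 / 64 * d}"
    by (auto simp: field_simps)
  then have "real (card {y \<in> cube d. 64 * hdist x y \<le> 31 * d}) \<le> (31 / 16) ^ d / (15 / 16) powr (31 / 64 * d)"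
    using card_ball_le[OF assms, of "15 / 16" "31 / 64 * d"] by simp
  also have "\<dots> = 2 ^ d * ((31 / 32) ^ d * (16 / 15) powr (31 / 64 * d))"
    by (simp add: powr_divide field_simps power_divide power_mult_distrib [symmetric])
  also have "(31 / 32) ^ d * (16 / 15) powr (31 / 64 * d) = ((31 / 32) * (16 / 15 :: real) powr (31 / 64)) powr d"
    by (simp only: powr_mult powr_powr powr_realpow flip: powr_realpow)
  also have "\<dots> = 2 powr (- tail_rate * d)"
    unfolding tail_rate_def by (simp add: powr_powr [symmetric] powr_log_cancel)
  finally show ?thesis .
qed

text \<open>At \<open>a = 1/8\<close> the two factors from \<open>card_ball_le\<close>,
  \<open>(9/8) ^ d\<close> and \<open>8 powr (d/16)\<close>, are each at most
  \<open>2 powr (12/64 * d)\<close>.\<close>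

lemma card_near_le:
  assumes "x \<in> cube d"
  shows "real (card {y \<in> cube d. 16 * hdist y x \<le> d}) \<le> 2 powr (24 / 64 * d)"
proof -
  have "{y \<in> cube d. 16 * hdist y x \<le> d} = {y \<in> cube d. real (hdist x y) \<le> 1 / 16 * d}"
    by (auto simp: field_simps hdist_def)
  then have "real (card {y \<in> cube d. 16 * hdist y x \<le> d}) \<le> (9 / 8) ^ d / (1 / 8) powr (1 / 16 * d)"
    using card_ball_le[OF assms, of "1 / 8" "1 / 16 * d"] by simp
  also have "\<dots> = (9 / 8) ^ d * 8 powr (1 / 16 * d)"
    by (simp add: powr_divide)
  also have "8 powr (1 / 16 * d) = 2 powr (12 / 64 * d)"
    using powr_powr[of 2 3 "1 / 16 * d"] by simp
  also have "(9 / 8 :: real) \<le> 2 powr (12 / 64)"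
  proof (rule power_le_imp_le_base)
    \<comment> \<open>The 16th powers compare \<open>(9/8) ^ 16\<close> with \<open>2 ^ 3\<close>;
      the form \<open>Suc 15\<close> fits \<open>power_le_imp_le_base\<close>.\<close>
    show "(9 / 8 :: real) ^ Suc 15 \<le> (2 powr (12 / 64)) ^ Suc 15"
      by (simp add: powr_power power_divide)
  qed simp
  then have "(9 / 8 :: real) ^ d \<le> (2 powr (12 / 64)) ^ d"
    by (intro power_mono) auto
  also have "(2 powr (12 / 64)) ^ d = 2 powr (12 / 64 * d)"
    by (simp add: powr_power mult.commute)
  also have "2 powr (12 / 64 * real d) * 2 powr (12 / 64 * d) = 2 powr (24 / 64 * d)"
    by (simp flip: powr_add)
  finally show ?thesis by simp
qed

section \<open>The three functions and the inputs of moderate weight\<close>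

definition high_set :: "nat \<Rightarrow> point \<Rightarrow> bool" where
  "high_set d y \<longleftrightarrow> 31 * d \<le> 64 * wt y"

text \<open>\<open>high_set\<close>, \<open>cut\<close> and \<open>far_cut\<close> are
  \<open>F\<close>, \<open>G\<close> and \<open>H\<close> of the introduction. As \<open>cut\<close>
  depends on \<open>z\<close> alone, queries made on it can only guess where \<open>x\<close>
  is.\<close>

definition cut :: "nat \<Rightarrow> point \<Rightarrow> point \<Rightarrow> bool" where
  "cut d z y \<longleftrightarrow> high_set d y \<and> \<not> cube_le y z"

definition far_cut :: "nat \<Rightarrow> point \<Rightarrow> point \<Rightarrow> point \<Rightarrow> bool" where
  "far_cut d x z y \<longleftrightarrow> high_set d y \<and> \<not> (cube_le y z \<and> d < 16 * hdist x y)"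

text \<open>The weight bound serves twice: it gives far points of \<open>high_set\<close> many ones
  outside \<open>x\<close>, and it keeps the fibres of the join small.\<close>

definition light :: "nat \<Rightarrow> point set" where
  "light d = {x \<in> cube d. 64 * wt x \<le> 33 * d}"

lemma light_subset: "light d \<subseteq> cube d"
  by (auto simp: light_def)

lemma finite_light [simp]: "finite (light d)"
  by (rule finite_subset[OF light_subset]) simp

text \<open>More than \<open>33d/64\<close> ones leave fewer than \<open>31d/64\<close> zeros, which
  puts the point into the ball around the all-ones point.\<close>

lemma card_heavy_le: "real (card (cube d - light d)) \<le> 2 ^ d * 2 powr (- tail_rate * d)"
proof -
  have "cube d - light d \<subseteq> {y \<in> cube d. 64 * hdist (replicate d True) y \<le> 31 * d}"
  proof
    fix x assume "x \<in> cube d - light d"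
    then show "x \<in> {y \<in> cube d. 64 * hdist (replicate d True) y \<le> 31 * d}"
      using hdist_True[of x d] by (auto simp: light_def cube_def)
  qed
  then have "card (cube d - light d) \<le> card {y \<in> cube d. 64 * hdist (replicate d True) y \<le> 31 * d}"
    by (intro card_mono) auto
  also have "real \<dots> \<le> 2 ^ d * 2 powr (- tail_rate * d)"
    by (rule card_tail_le) (simp add: cube_def)
  finally show ?thesis by simp
qed

lemma card_low_le: "real (card {y \<in> cube d. \<not> high_set d y}) \<le> 2 ^ d * 2 powr (- tail_rate * d)"
proof -
  have "{y \<in> cube d. \<not> high_set d y} \<subseteq> {y \<in> cube d. 64 * hdist (replicate d False) y \<le> 31 * d}"
    by (auto simp: high_set_def cube_def hdist_False)
  then have "card {y \<in> cube d. \<not> high_set d y} \<le> card {y \<in> cube d. 64 * hdist (replicate d False) y \<le> 31 * d}"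
    by (intro card_mono) auto
  also have "real \<dots> \<le> 2 ^ d * 2 powr (- tail_rate * d)"
    by (rule card_tail_le) (simp add: cube_def)
  finally show ?thesis by simp
qed

section \<open>Hiding: few queries rarely tell the functions apart\<close>

lemma result_diff_le:
  assumes "\<And>f. result t f \<in> {0..1}"
  shows "\<bar>result t f - result t g\<bar> \<le> (\<Sum>y\<in>set (calls t f). of_bool (f y \<noteq> g y))"
proof (cases "\<exists>y\<in>set (calls t f). f y \<noteq> g y")
  case True
  then obtain y where y: "y \<in> set (calls t f)" "f y \<noteq> g y" by blast
  have "\<bar>result t f - result t g\<bar> \<le> of_bool (f y \<noteq> g y)"
    using assms[of f] assms[of g] y by auto
  also have "\<dots> \<le> (\<Sum>y\<in>set (calls t f). of_bool (f y \<noteq> g y))"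
    using y by (intro member_le_sum) auto
  finally show ?thesis .
next
  case False
  \<comment> \<open>Adaptivity is harmless: if no query made on \<open>f\<close> sees a difference,
    the run on \<open>g\<close> is the same run.\<close>
  then have "result t f = result t g" by (intro result_cong) auto
  then show ?thesis by (simp add: sum_nonneg)
qed

lemma sum_set_le:
  fixes g :: "'a \<Rightarrow> real"
  assumes "\<And>y. y \<in> set ys \<Longrightarrow> g y \<le> B" "length ys \<le> q" "0 \<le> B"
  shows "sum g (set ys) \<le> real q * B"
proof -
  have "sum g (set ys) \<le> real (card (set ys)) * B"
    using assms(1) by (rule sum_bounded_above)
  also have "card (set ys) \<le> q"
    using card_length assms(2) by (rule order_trans)
  then have "real (card (set ys)) * B \<le> real q * B"
    using assms(3) by (intro mult_right_mono) auto
  finally show ?thesis .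
qed

text \<open>Only a high point far from \<open>x\<close> can see the difference, and only if
  \<open>w\<close> covers all of its at least \<open>d/64\<close> ones outside
  \<open>x\<close>.\<close>

lemma sum_far_hit_le:
  assumes "x \<in> light d" "y \<in> cube d"
  shows "(\<Sum>w\<in>cube d. of_bool (high_set d y \<noteq> far_cut d x (join x w) y)) \<le> (2 ^ d * 2 powr (- real d / 64) :: real)"
proof (cases "high_set d y \<and> d < 16 * hdist x y")
  case True
  have x: "x \<in> cube d" using assms light_subset by blast
  have "d \<le> 64 * excess y x"
    using True assms by (intro excess_ge_of_far[of x d y]) (auto simp: light_def high_set_def)
  then have *: "- real (excess y x) \<le> - real d / 64"
    by simp
  have "(\<Sum>w\<in>cube d. of_bool (high_set d y \<noteq> far_cut d x (join x w) y)) 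
      = (\<Sum>w\<in>cube d. of_bool (cube_le y (join x w)) :: real)"
    using True by (intro sum.cong) (auto simp: far_cut_def)
  also have "\<dots> = 2 ^ d * 2 powr (- real (excess y x))"
    using card_cover[OF x assms(2)] by (simp add: powr_minus powr_realpow field_simps)
  also have "\<dots> \<le> 2 ^ d * 2 powr (- real d / 64)"
    using * by (intro mult_left_mono powr_mono) auto
  finally show ?thesis .
next
  case False
  then have "high_set d y = far_cut d x (join x w) y" for w
    by (auto simp: far_cut_def)
  then show ?thesis by simp
qed

text \<open>Union bound: the queries made on \<open>high_set d\<close> do not depend on
  \<open>w\<close>, so the sums can be swapped and \<open>sum_far_hit_le\<close> applies to each
  query.\<close>

lemma sum_hide_at_x_le:
  assumes "x \<in> light d" "\<And>f. result t f \<in> {0..1}"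
    and "set (calls t (high_set d)) \<subseteq> cube d" "length (calls t (high_set d)) \<le> q"
  shows "(\<Sum>w\<in>cube d. \<bar>result t (high_set d) - result t (far_cut d x (join x w))\<bar>)
    \<le> real q * (2 ^ d * 2 powr (- real d / 64))"
proof -
  have "(\<Sum>w\<in>cube d. \<bar>result t (high_set d) - result t (far_cut d x (join x w))\<bar>)
    \<le> (\<Sum>w\<in>cube d. \<Sum>y\<in>set (calls t (high_set d)). of_bool (high_set d y \<noteq> far_cut d x (join x w) y))"
    by (intro sum_mono result_diff_le assms)
  also have "\<dots> = (\<Sum>y\<in>set (calls t (high_set d)). \<Sum>w\<in>cube d. of_bool (high_set d y \<noteq> far_cut d x (join x w) y))"
    by (rule sum.swap)
  also have "\<dots> \<le> real q * (2 ^ d * 2 powr (- real d / 64))"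
    using assms by (intro sum_set_le sum_far_hit_le) (auto simp del: sum_of_bool_eq)
  finally show ?thesis .
qed

text \<open>At most \<open>2 powr (24/64 * d)\<close> points \<open>x\<close> are near
  \<open>y\<close>, each with at most \<open>2 powr (33/64 * d)\<close> choices of \<open>w\<close>.
  The exponent 57/64 is relaxed to 63/64 to give both hiding errors the same form.\<close>

lemma sum_near_hit_le:
  assumes "z \<in> cube d" "y \<in> cube d"
  shows "(\<Sum>x\<in>light d. \<Sum>w\<in>cube d. of_bool (join x w = z) * of_bool (16 * hdist x y \<le> d))
    \<le> (2 ^ d * 2 powr (- real d / 64) :: real)"
proof -
  have "(\<Sum>x\<in>light d. \<Sum>w\<in>cube d. of_bool (join x w = z) * of_bool (16 * hdist x y \<le> d) :: real)
      = (\<Sum>x\<in>light d. of_bool (16 * hdist x y \<le> d) * (\<Sum>w\<in>cube d. of_bool (join x w = z)))"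
    by (simp add: sum_distrib_left mult.commute)
  also have "\<dots> \<le> (\<Sum>x\<in>light d. of_bool (16 * hdist x y \<le> d) * 2 powr (33 / 64 * d))"
  proof (intro sum_mono mult_left_mono)
    fix x assume x: "x \<in> light d"
    then have "(\<Sum>w\<in>cube d. of_bool (join x w = z) :: real) \<le> 2 ^ wt x"
      using light_subset assms by (intro card_join_fibre) auto
    also have "\<dots> = 2 powr (wt x)" by (simp add: powr_realpow)
    also have "\<dots> \<le> 2 powr (33 / 64 * d)"
      using x by (intro powr_mono) (auto simp: light_def)
    finally show "(\<Sum>w\<in>cube d. of_bool (join x w = z) :: real) \<le> 2 powr (33 / 64 * d)" .
  qed auto
  also have "\<dots> \<le> (\<Sum>x\<in>cube d. of_bool (16 * hdist x y \<le> d) * 2 powr (33 / 64 * d))"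
    using light_subset by (intro sum_mono2) auto
  also have "\<dots> = real (card {x \<in> cube d. 16 * hdist x y \<le> d}) * 2 powr (33 / 64 * d)"
    by (simp flip: sum_distrib_right add: of_bool_def sum.If_cases Int_def)
  also have "\<dots> \<le> 2 powr (24 / 64 * d) * 2 powr (33 / 64 * d)"
    by (intro mult_right_mono card_near_le assms) auto
  also have "\<dots> = 2 powr (57 / 64 * d)"
    by (simp flip: powr_add)
  also have "\<dots> \<le> 2 powr (63 / 64 * d)"
    by (intro powr_mono) auto
  also have "\<dots> = 2 powr d * 2 powr (- real d / 64)"
    by (simp flip: powr_add)
  finally show ?thesis by (simp add: powr_realpow)
qed

lemma sum_hide_at_z_le:
  assumes res: "\<And>z f. z \<in> cube d \<Longrightarrow> result (t z) f \<in> {0..1}"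
    and calls: "\<And>z f. z \<in> cube d \<Longrightarrow> set (calls (t z) f) \<subseteq> cube d"
    and len: "\<And>z f. z \<in> cube d \<Longrightarrow> length (calls (t z) f) \<le> q"
  shows "(\<Sum>x\<in>light d. \<Sum>w\<in>cube d.
      \<bar>result (t (join x w)) (cut d (join x w)) - result (t (join x w)) (far_cut d x (join x w))\<bar>)
    \<le> 2 ^ d * (real q * (2 ^ d * 2 powr (- real d / 64)))"
proof -
  let ?Q = "\<lambda>z. set (calls (t z) (cut d z))"
  \<comment> \<open>The redundant index \<open>z\<close>, tied to \<open>join x w\<close> by an
    indicator, makes the query set independent of \<open>x\<close> and \<open>w\<close>. The swaps
    below then leave, for fixed \<open>z\<close> and \<open>y\<close>, a count over \<open>x\<close>
    and \<open>w\<close>.\<close>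
  have "(\<Sum>x\<in>light d. \<Sum>w\<in>cube d.
      \<bar>result (t (join x w)) (cut d (join x w)) - result (t (join x w)) (far_cut d x (join x w))\<bar>)
    \<le> (\<Sum>x\<in>light d. \<Sum>w\<in>cube d. \<Sum>z\<in>cube d. \<Sum>y\<in>?Q z. of_bool (join x w = z) * of_bool (16 * hdist x y \<le> d))"
  proof (intro sum_mono)
    fix x w assume "x \<in> light d" and w: "w \<in> cube d"
    then have x: "x \<in> cube d" using light_subset by blast
    define z where "z = join x w"
    have z: "z \<in> cube d" using x w by (simp add: z_def join_in_cube)
    have "\<bar>result (t z) (cut d z) - result (t z) (far_cut d x z)\<bar>
      \<le> (\<Sum>y\<in>?Q z. of_bool (cut d z y \<noteq> far_cut d x z y))"
      using z res by (intro result_diff_le) auto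
    \<comment> \<open>\<open>G\<close> and \<open>H\<close> differ only at points below
      \<open>z\<close> that are near \<open>x\<close>.\<close>
    also have "\<dots> \<le> (\<Sum>y\<in>?Q z. of_bool (join x w = z) * of_bool (16 * hdist x y \<le> d))"
      by (intro sum_mono) (auto simp: cut_def far_cut_def z_def)
    also have "\<dots> \<le> (\<Sum>z\<in>cube d. \<Sum>y\<in>?Q z. of_bool (join x w = z) * of_bool (16 * hdist x y \<le> d))"
      using z by (intro member_le_sum) (auto intro!: sum_nonneg)
    finally show "\<bar>result (t (join x w)) (cut d (join x w)) - result (t (join x w)) (far_cut d x (join x w))\<bar>
      \<le> (\<Sum>z\<in>cube d. \<Sum>y\<in>?Q z. of_bool (join x w = z) * of_bool (16 * hdist x y \<le> d))"
      by (simp add: z_def)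
  qed
  also have "\<dots> = (\<Sum>x\<in>light d. \<Sum>z\<in>cube d. \<Sum>w\<in>cube d. \<Sum>y\<in>?Q z. of_bool (join x w = z) * of_bool (16 * hdist x y \<le> d))"
    by (rule sum.cong[OF refl], rule sum.swap)
  also have "\<dots> = (\<Sum>z\<in>cube d. \<Sum>x\<in>light d. \<Sum>w\<in>cube d. \<Sum>y\<in>?Q z. of_bool (join x w = z) * of_bool (16 * hdist x y \<le> d))"
    by (rule sum.swap)
  also have "\<dots> = (\<Sum>z\<in>cube d. \<Sum>x\<in>light d. \<Sum>y\<in>?Q z. \<Sum>w\<in>cube d. of_bool (join x w = z) * of_bool (16 * hdist x y \<le> d))"
    by (rule sum.cong[OF refl], rule sum.cong[OF refl], rule sum.swap)
  also have "\<dots> = (\<Sum>z\<in>cube d. \<Sum>y\<in>?Q z. \<Sum>x\<in>light d. \<Sum>w\<in>cube d. of_bool (join x w = z) * of_bool (16 * hdist x y \<le> d))"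
    by (rule sum.cong[OF refl], rule sum.swap)
  also have "\<dots> \<le> (\<Sum>z\<in>cube d. real q * (2 ^ d * 2 powr (- real d / 64)))"
  proof (rule sum_mono)
    fix z assume z: "z \<in> cube d"
    show "(\<Sum>y\<in>?Q z. \<Sum>x\<in>light d. \<Sum>w\<in>cube d. of_bool (join x w = z) * of_bool (16 * hdist x y \<le> d))
      \<le> real q * (2 ^ d * 2 powr (- real d / 64))"
      using z calls[OF z] len[OF z] by (intro sum_set_le sum_near_hit_le) (auto simp del: sum_of_bool_eq)
  qed
  also have "\<dots> = 2 ^ d * (real q * (2 ^ d * 2 powr (- real d / 64)))"
    by (simp add: card_cube)
  finally show ?thesis .
qed

text \<open>
  Measurability of \<open>good\<close> is not an issue: a non-measurable set has \<open>measure\<close> 0, which forces \<open>1 \<le> \<delta>\<close>.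
\<close>

lemma (in prob_space) integral_le_of_good:
  fixes \<phi> :: "'a \<Rightarrow> real"
  assumes "\<phi> \<in> borel_measurable M" "\<And>s. s \<in> space M \<Longrightarrow> \<phi> s \<in> {0..1}"
    and "\<And>s. s \<in> good \<Longrightarrow> \<phi> s \<le> 0" and good: "1 - \<delta> \<le> measure M good"
  shows "(\<integral>s. \<phi> s \<partial>M) \<le> \<delta>"
proof (cases "good \<in> events")
  case True
  have "(\<integral>s. \<phi> s \<partial>M) \<le> (\<integral>s. indicator (space M - good) s \<partial>M)"
  proof (rule integral_mono)
    show "integrable M \<phi>"
      using assms by (intro integrable_const_bound[where B = 1]) auto
    show "integrable M (indicator (space M - good) :: 'a \<Rightarrow> real)"
      using True by (intro integrable_const_bound[where B = 1]) (auto simp: indicator_def)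
  qed (use assms in \<open>auto simp: indicator_def\<close>)
  also have "\<dots> = 1 - measure M good"
    using True by (simp add: prob_compl)
  finally show ?thesis using good by simp
next
  case False
  have "(\<integral>s. \<phi> s \<partial>M) \<le> (\<integral>s. 1 \<partial>M)"
    using assms by (intro integral_mono integrable_const_bound[where B = 1]) auto
  then show ?thesis using good False by (simp add: measure_notin_sets prob_space)
qed

section \<open>The expected output as an average over the cube\<close>

lemma expect_output_eq_sum:
  assumes "meta_algorithm S A"
  shows "expect_output S A d f = (\<Sum>x\<in>cube d. \<integral>s. result (A d s x) f \<partial>S d) / 2 ^ d"
proof -
  let ?U = "uniform_count_measure (cube d)"
  let ?g = "\<lambda>(x, s). result (A d s x) f"
  interpret U: prob_space ?U by (rule prob_space_uniform_count_measure) auto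
  interpret S: prob_space "S d" using assms by (simp add: meta_algorithm_def)
  interpret P: pair_prob_space ?U "S d" ..
  \<comment> \<open>The cube is countable, so measurability in the seed for each input gives joint
    measurability.\<close>
  have "?g \<in> borel_measurable (count_space (cube d) \<Otimes>\<^sub>M S d)"
    using assms by (intro measurable_pair_measure_countable1) (auto simp: meta_algorithm_def countable_finite)
  then have [measurable]: "?g \<in> borel_measurable (?U \<Otimes>\<^sub>M S d)"
    by (simp cong: measurable_cong_sets sets_pair_measure_cong add: sets_uniform_count_measure_count_space)
  have "integrable (?U \<Otimes>\<^sub>M S d) ?g"
    using assms
    by (intro P.P.integrable_const_bound[where B = 1])
       (auto simp: space_pair_measure space_uniform_count_measure meta_algorithm_def intro!: AE_I2)
  then have "expect_output S A d f = (\<integral>x. \<integral>s. result (A d s x) f \<partial>S d \<partial>?U)"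
    unfolding expect_output_def by (subst P.integral_fst' [symmetric]) auto
  also have "\<dots> = (\<Sum>x\<in>cube d. \<integral>s. result (A d s x) f \<partial>S d) / 2 ^ d"
    by (simp add: integral_uniform_count_measure card_cube)
  finally show ?thesis .
qed

section \<open>The error bound in a fixed dimension\<close>

lemma cut_output_le_0:
  assumes "cube_feasible d (cut d z) g" "z \<in> cube d"
  shows "g z \<le> 0"
proof -
  \<comment> \<open>Reflexivity makes the set under \<open>Max\<close> nonempty.\<close>
  have "cube_le z z" by (simp add: cube_le_def list_all2_same)
  then have "Max ((\<lambda>y. of_bool (cut d z y) :: real) ` {y \<in> cube d. cube_le y z}) \<le> 0"
    using assms(2) by (intro Max.boundedI) (auto simp: cut_def)
  moreover have "g z \<le> Max ((\<lambda>y. of_bool (cut d z y)) ` {y \<in> cube d. cube_le y z})"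
    using assms by (auto simp: cube_feasible_def)
  ultimately show ?thesis by linarith
qed

text \<open>The \<open>tail_rate\<close> term pays for the inputs outside \<open>light\<close>, and
  each of the two hiding errors contributes one term with \<open>q\<close>.\<close>

lemma expect_output_high_set_le:
  fixes q :: nat
  assumes meta: "meta_algorithm S A"
    and fail: "infeasible_or_nonmono_with_prob S A \<delta>"
    and len: "\<And>s x f. s \<in> space (S d) \<Longrightarrow> x \<in> cube d \<Longrightarrow> length (calls (A d s x) f) \<le> q"
  shows "expect_output S A d (high_set d)
    \<le> 2 * \<delta> d + (2 powr (- tail_rate * d) + (q * 2 powr (- real d / 64) + q * 2 powr (- real d / 64)))"
proof -
  interpret S: prob_space "S d" using meta by (simp add: meta_algorithm_def)
  define R where "R = (\<lambda>s x f. result (A d s x) f)"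
  define \<epsilon> where "\<epsilon> = q * 2 powr (- real d / 64)"
  let ?L = "light d" and ?F = "high_set d" and ?H = "far_cut d" and ?G = "cut d"
  have R01: "R s x f \<in> {0..1}" if "s \<in> space (S d)" "x \<in> cube d" for s x f
    using meta that by (simp add: meta_algorithm_def R_def)
  have R_meas [measurable]: "(\<lambda>s. R s x f) \<in> borel_measurable (S d)" if "x \<in> cube d" for x f
    using meta that by (simp add: meta_algorithm_def R_def)
  have R_int: "integrable (S d) (\<lambda>s. R s x f)" if "x \<in> cube d" for x f
    using R01 R_meas that by (intro S.integrable_const_bound[where B = 1]) auto
  have calls: "set (calls (A d s x) f) \<subseteq> cube d" if "s \<in> space (S d)" "x \<in> cube d" for s x f
    using meta that by (simp add: meta_algorithm_def)
  have good: "1 - \<delta> d \<le> measure (S d) {s \<in> space (S d). cube_mono d (\<lambda>x. R s x f) \<and> cube_feasible d f (\<lambda>x. R s x f)}" for f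
    using fail by (simp add: infeasible_or_nonmono_with_prob_def R_def)
  \<comment> \<open>The sign allows \<open>card ?L\<close> to be replaced by \<open>2 ^ d\<close> in
    front of \<open>\<delta> d\<close>.\<close>
  have \<delta>: "0 \<le> \<delta> d"
    using order_trans[OF good S.prob_le_1] by simp
  have L: "x \<in> cube d" if "x \<in> ?L" for x
    using that light_subset by blast
  have cardL: "real (card ?L) \<le> 2 ^ d"
    using card_mono[OF finite_cube light_subset, of d] by (simp add: card_cube numeral_power_le_of_nat_cancel_iff flip: of_nat_le_iff)

  \<comment> \<open>The set of queried points need not be measurable in the seed, only the result is. Hence the two
    hiding errors are integrated as differences of results and bounded seed by seed.\<close>
  define D1 where "D1 = (\<lambda>s x w. \<bar>R s x ?F - R s x (?H x (join x w))\<bar>)"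
  define D2 where "D2 = (\<lambda>s x w. \<bar>R s (join x w) (?G (join x w)) - R s (join x w) (?H x (join x w))\<bar>)"
  have D_int: "integrable (S d) (\<lambda>s. D1 s x w)" "integrable (S d) (\<lambda>s. D2 s x w)"
    if "x \<in> cube d" "w \<in> cube d" for x w
    using that R_int by (auto simp: D1_def D2_def join_in_cube)

  have step: "(\<integral>s. R s x ?F \<partial>S d) \<le> (\<integral>s. D1 s x w \<partial>S d) + (\<integral>s. D2 s x w \<partial>S d) + 2 * \<delta> d"
    if x: "x \<in> cube d" and w: "w \<in> cube d" for x w
  proof -
    define z where "z = join x w"
    have z: "z \<in> cube d" using x w by (simp add: z_def join_in_cube)
    have xz: "cube_le x z" using x w by (simp add: z_def cube_le_join)
    \<comment> \<open>The positive part lies in the unit interval for every seed and vanishes when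
      the output on \<open>H\<close> is monotone, so \<open>integral_le_of_good\<close>
      applies.\<close>
    let ?m = "\<lambda>s. max 0 (R s x (?H x z) - R s z (?H x z))"
    have m_int: "integrable (S d) ?m"
      using R_int x z by (intro integrable_max) auto
    have m: "(\<integral>s. ?m s \<partial>S d) \<le> \<delta> d"
    proof (rule S.integral_le_of_good[OF _ _ _ good[of "?H x z"]])
      show "?m \<in> borel_measurable (S d)" using m_int by auto
      show "?m s \<in> {0..1}" if "s \<in> space (S d)" for s
        using R01[OF that x, of "?H x z"] R01[OF that z, of "?H x z"] by auto
    qed (use x z xz in \<open>auto simp: cube_mono_def\<close>)
    have g: "(\<integral>s. R s z (?G z) \<partial>S d) \<le> \<delta> d"
    proof (rule S.integral_le_of_good[OF _ _ _ good[of "?G z"]])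
      show "R s z (?G z) \<le> 0"
        if "s \<in> {s \<in> space (S d). cube_mono d (\<lambda>x. R s x (?G z)) \<and> cube_feasible d (?G z) (\<lambda>x. R s x (?G z))}" for s
        using that cut_output_le_0[of d z "\<lambda>x. R s x (?G z)"] z by simp
    qed (use R_meas R01 z in auto)
    \<comment> \<open>Seed by seed: from \<open>F\<close> to \<open>H\<close> at \<open>x\<close>
      with error \<open>D1\<close>, from \<open>x\<close> to \<open>z\<close> on \<open>H\<close>
      with error \<open>?m\<close>, from \<open>H\<close> to \<open>G\<close> at \<open>z\<close>
      with error \<open>D2\<close>.\<close>
    have "(\<integral>s. R s x ?F \<partial>S d) \<le> (\<integral>s. D1 s x w + D2 s x w + (?m s + R s z (?G z)) \<partial>S d)"
      using D_int[OF x w] m_int R_int x z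
      by (intro integral_mono) (auto simp: D1_def D2_def z_def)
    also have "\<dots> = (\<integral>s. D1 s x w \<partial>S d) + (\<integral>s. D2 s x w \<partial>S d) + ((\<integral>s. ?m s \<partial>S d) + (\<integral>s. R s z (?G z) \<partial>S d))"
      using D_int[OF x w] m_int R_int[OF z]
      by (simp add: Bochner_Integration.integral_add)
    finally show ?thesis using m g by linarith
  qed

  have D1: "(\<Sum>x\<in>?L. \<Sum>w\<in>cube d. D1 s x w) \<le> 2 ^ d * (2 ^ d * \<epsilon>)" if s: "s \<in> space (S d)" for s
  proof -
    have "(\<Sum>x\<in>?L. \<Sum>w\<in>cube d. D1 s x w) \<le> (\<Sum>x\<in>?L. q * (2 ^ d * 2 powr (- real d / 64)))"
      unfolding D1_def R_def
    proof (rule sum_mono)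
      fix x assume x: "x \<in> ?L"
      note x' = L[OF x]
      show "(\<Sum>w\<in>cube d. \<bar>result (A d s x) ?F - result (A d s x) (?H x (join x w))\<bar>)
        \<le> q * (2 ^ d * 2 powr (- real d / 64))"
        by (rule sum_hide_at_x_le[OF x R01[OF s x', unfolded R_def] calls[OF s x'] len[OF s x']])
    qed
    also have "\<dots> = card ?L * (2 ^ d * \<epsilon>)"
      by (simp add: \<epsilon>_def)
    also have "\<dots> \<le> 2 ^ d * (2 ^ d * \<epsilon>)"
      using cardL by (intro mult_right_mono) (auto simp: \<epsilon>_def)
    finally show ?thesis .
  qed
  have D2: "(\<Sum>x\<in>?L. \<Sum>w\<in>cube d. D2 s x w) \<le> 2 ^ d * (2 ^ d * \<epsilon>)" if s: "s \<in> space (S d)" for s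
    using sum_hide_at_z_le[of d "A d s" q] R01[OF s] calls[OF s] len[OF s]
    by (simp add: D2_def R_def \<epsilon>_def algebra_simps)
  have ED: "(\<Sum>x\<in>?L. \<Sum>w\<in>cube d. \<integral>s. D s x w \<partial>S d) \<le> 2 ^ d * (2 ^ d * \<epsilon>)"
    if int: "\<And>x w. x \<in> cube d \<Longrightarrow> w \<in> cube d \<Longrightarrow> integrable (S d) (\<lambda>s. D s x w)"
      and le: "\<And>s. s \<in> space (S d) \<Longrightarrow> (\<Sum>x\<in>?L. \<Sum>w\<in>cube d. D s x w) \<le> 2 ^ d * (2 ^ d * \<epsilon>)"
    for D :: "'a \<Rightarrow> point \<Rightarrow> point \<Rightarrow> real"
  proof -
    have "(\<Sum>x\<in>?L. \<Sum>w\<in>cube d. \<integral>s. D s x w \<partial>S d) = (\<integral>s. (\<Sum>x\<in>?L. \<Sum>w\<in>cube d. D s x w) \<partial>S d)"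
      using int L by (simp add: Bochner_Integration.integral_sum)
    also have "\<dots> \<le> (\<integral>s. 2 ^ d * (2 ^ d * \<epsilon>) \<partial>S d)"
      using int L le by (intro integral_mono) auto
    finally show ?thesis by (simp add: S.prob_space)
  qed

  \<comment> \<open>The summand is constant in \<open>w\<close>; summing over \<open>w\<close>
    brings in the random point \<open>z\<close>.\<close>
  have "2 ^ d * (\<Sum>x\<in>?L. \<integral>s. R s x ?F \<partial>S d) = (\<Sum>x\<in>?L. \<Sum>w\<in>cube d. \<integral>s. R s x ?F \<partial>S d)"
    by (simp add: card_cube sum_distrib_left)
  also have "\<dots> \<le> (\<Sum>x\<in>?L. \<Sum>w\<in>cube d. (\<integral>s. D1 s x w \<partial>S d) + (\<integral>s. D2 s x w \<partial>S d) + 2 * \<delta> d)"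
    using L by (intro sum_mono step) auto
  also have "\<dots> = (\<Sum>x\<in>?L. \<Sum>w\<in>cube d. \<integral>s. D1 s x w \<partial>S d) + (\<Sum>x\<in>?L. \<Sum>w\<in>cube d. \<integral>s. D2 s x w \<partial>S d)
      + card ?L * (2 ^ d * (2 * \<delta> d))"
    by (simp add: sum.distrib card_cube)
  also have "\<dots> \<le> 2 ^ d * (2 ^ d * \<epsilon>) + 2 ^ d * (2 ^ d * \<epsilon>) + 2 ^ d * (2 ^ d * (2 * \<delta> d))"
    using cardL \<delta> by (intro add_mono ED D_int D1 D2 mult_right_mono) auto
  also have "\<dots> = 2 ^ d * (2 ^ d * (2 * \<delta> d + (\<epsilon> + \<epsilon>)))"
    by (simp add: algebra_simps)
  finally have light: "(\<Sum>x\<in>?L. \<integral>s. R s x ?F \<partial>S d) \<le> 2 ^ d * (2 * \<delta> d + (\<epsilon> + \<epsilon>))"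
    by simp
  \<comment> \<open>Inputs outside \<open>light\<close> are so few that the trivial bound 1
    suffices.\<close>
  have "(\<integral>s. R s x ?F \<partial>S d) \<le> 1" if "x \<in> cube d - ?L" for x
    using that R01 by (intro S.integral_le_const R_int) auto
  then have "(\<Sum>x\<in>cube d - ?L. \<integral>s. R s x ?F \<partial>S d) \<le> (\<Sum>x\<in>cube d - ?L. 1)"
    by (intro sum_mono) auto
  also have "\<dots> \<le> 2 ^ d * 2 powr (- tail_rate * d)"
    using card_heavy_le by simp
  finally have heavy: "(\<Sum>x\<in>cube d - ?L. \<integral>s. R s x ?F \<partial>S d) \<le> 2 ^ d * 2 powr (- tail_rate * d)" .
  have "(\<Sum>x\<in>cube d. \<integral>s. R s x ?F \<partial>S d)
      = (\<Sum>x\<in>cube d - ?L. \<integral>s. R s x ?F \<partial>S d) + (\<Sum>x\<in>?L. \<integral>s. R s x ?F \<partial>S d)"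
    by (rule sum.subset_diff) (auto simp: light_subset)
  also have "\<dots> \<le> 2 ^ d * (2 * \<delta> d + (2 powr (- tail_rate * d) + (\<epsilon> + \<epsilon>)))"
    using light heavy by (simp add: algebra_simps)
  finally show ?thesis
    by (simp add: expect_output_eq_sum[OF meta] R_def \<epsilon>_def field_simps)
qed

lemma expect_input_high_set: "1 - expect_input d (high_set d) \<le> 2 powr (- tail_rate * d)"
proof -
  have "expect_input d (high_set d) = (\<Sum>x\<in>cube d. of_bool (high_set d x)) / 2 ^ d"
    by (simp add: expect_input_def integral_uniform_count_measure card_cube)
  moreover have "(\<Sum>x\<in>cube d. of_bool (high_set d x)) + (\<Sum>x\<in>cube d. of_bool (\<not> high_set d x)) = (\<Sum>x\<in>cube d. 1 :: real)"
    unfolding sum.distrib [symmetric] by (intro sum.cong) auto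
  moreover have "(\<Sum>x\<in>cube d. of_bool (\<not> high_set d x)) \<le> (2 ^ d * 2 powr (- tail_rate * d) :: real)"
    using card_low_le[of d] by (simp add: Int_def)
  ultimately have "2 ^ d * (1 - expect_input d (high_set d)) \<le> 2 ^ d * 2 powr (- tail_rate * d)"
    by (simp add: card_cube field_simps del: sum_of_bool_eq)
  then show ?thesis
    by (simp only: mult_le_cancel_left_pos zero_less_power zero_less_numeral)
qed

section \<open>Calculus of exponentially small sequences\<close>

lemma exp_small_mono:
  assumes "exp_small h" "\<And>d. g d \<le> h d"
  shows "exp_small g"
proof -
  obtain c where "c > 0" "\<forall>\<^sub>F d in sequentially. h d \<le> 2 powr (- c * real d)"
    using assms(1) by (auto simp: exp_small_def)
  moreover from this(2) have "\<forall>\<^sub>F d in sequentially. g d \<le> 2 powr (- c * real d)"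
    by (rule eventually_mono) (rule order_trans[OF assms(2)])
  ultimately show ?thesis by (auto simp: exp_small_def)
qed

lemma exp_small_powr: "c > 0 \<Longrightarrow> exp_small (\<lambda>d. 2 powr (- c * real d))"
  by (auto simp: exp_small_def)

lemma exp_small_add:
  assumes "exp_small g" "exp_small h"
  shows "exp_small (\<lambda>d. g d + h d)"
proof -
  obtain b c where bc: "b > 0" "c > 0" "\<forall>\<^sub>F d in sequentially. g d \<le> 2 powr (- b * real d)"
      "\<forall>\<^sub>F d in sequentially. h d \<le> 2 powr (- c * real d)"
    using assms by (auto simp: exp_small_def)
  \<comment> \<open>Half of the smaller rate is given up: the factor 2 from the addition is at most
    \<open>2 powr (a * d)\<close> once \<open>1 / a \<le> d\<close>.\<close>
  define a where "a = min b c / 2"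
  have a: "a > 0" using bc by (simp add: a_def)
  have "\<forall>\<^sub>F d in sequentially. 1 / a \<le> real d"
    using filterlim_real_sequentially by (simp add: filterlim_at_top)
  with bc(3,4) have "\<forall>\<^sub>F d in sequentially. g d + h d \<le> 2 powr (- a * real d)"
  proof eventually_elim
    case (elim d)
    have "- b * real d \<le> - (2 * a) * real d" "- c * real d \<le> - (2 * a) * real d"
      by (intro mult_right_mono; simp add: a_def)+
    then have "2 powr (- b * real d) \<le> 2 powr (- (2 * a) * real d)" "2 powr (- c * real d) \<le> 2 powr (- (2 * a) * real d)"
      by (intro powr_mono; simp)+
    then have "g d + h d \<le> 2 powr 1 * 2 powr (- (2 * a) * real d)"
      using elim unfolding powr_one[OF zero_le_numeral] by linarith
    also have "\<dots> = 2 powr (1 - 2 * a * real d)"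
      by (simp add: powr_diff powr_minus_divide)
    also have "\<dots> \<le> 2 powr (- a * real d)"
      using elim a by (intro powr_mono) (simp_all add: field_simps)
    finally show ?case .
  qed
  with a show ?thesis by (auto simp: exp_small_def)
qed

lemma exp_small_subexponential:
  assumes "subexponential q" "c > 0"
  shows "exp_small (\<lambda>d. q d * 2 powr (- c * real d))"
proof -
  obtain e where e: "e \<in> o(\<lambda>d. real d)" "\<forall>\<^sub>F d in sequentially. real (q d) \<le> 2 powr e d"
    using assms by (auto simp: subexponential_def)
  \<comment> \<open>The exponent \<open>e d\<close> eventually uses up at most half of
    \<open>c * d\<close>; the other half remains as decay.\<close>
  have "\<forall>\<^sub>F d in sequentially. norm (e d) \<le> c / 2 * norm (real d)"
    using landau_o.smallD[OF e(1), of "c / 2"] assms by simp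
  with e(2) have "\<forall>\<^sub>F d in sequentially. q d * 2 powr (- c * real d) \<le> 2 powr (- (c / 2) * real d)"
  proof eventually_elim
    case (elim d)
    have "q d * 2 powr (- c * real d) \<le> 2 powr e d * 2 powr (- c * real d)"
      using elim by (intro mult_right_mono) auto
    also have "\<dots> = 2 powr (e d + - c * real d)"
      by (simp flip: powr_add)
    also have "\<dots> \<le> 2 powr (- (c / 2) * real d)"
      using elim by (intro powr_mono) auto
    finally show ?case .
  qed
  then show ?thesis using assms(2) unfolding exp_small_def by (intro exI[of _ "c / 2"]) auto
qed

section \<open>From the query complexity to the two claims\<close>

lemma length_calls_le:
  assumes "query_complexity S A d = enat q" "s \<in> space (S d)" "x \<in> cube d"
  shows "length (calls (A d s x) f) \<le> q"
proof -
  have "enat (length (calls (A d s x) f)) \<le> query_complexity S A d"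
    unfolding query_complexity_def using assms(2,3) by (meson SUP_upper2 UNIV_I order_refl)
  then show ?thesis using assms(1) by simp
qed

text \<open>This turns the first claim into the case \<open>\<delta> = 0\<close> of the
  second.\<close>

lemma infeasible_or_nonmono_with_prob_0:
  assumes "meta_algorithm S A" "feasible S A" "fixes_monotonicity S A"
  shows "infeasible_or_nonmono_with_prob S A (\<lambda>_. 0)"
  unfolding infeasible_or_nonmono_with_prob_def
proof (intro allI)
  fix d f
  interpret prob_space "S d" using assms by (simp add: meta_algorithm_def)
  have "{s \<in> space (S d). cube_mono d (\<lambda>x. result (A d s x) f) \<and> cube_feasible d f (\<lambda>x. result (A d s x) f)} = space (S d)"
    using assms by (auto simp: feasible_def fixes_monotonicity_def)
  then show "1 - 0 \<le> measure (S d) {s \<in> space (S d).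
      cube_mono d (\<lambda>x. result (A d s x) f) \<and> cube_feasible d f (\<lambda>x. result (A d s x) f)}"
    by (simp add: prob_space)
qed

theorem theorem2:
  fixes S :: "nat \<Rightarrow> 's measure" and A :: "'s algorithm" and q :: "nat \<Rightarrow> nat"
  assumes "meta_algorithm S A"
    and "\<And>d. query_complexity S A d = enat (q d)"
    and "subexponential q"
  shows "(feasible S A \<and> fixes_monotonicity S A \<longrightarrow>
            (\<exists>f :: nat \<Rightarrow> point \<Rightarrow> bool.
               exp_small (\<lambda>d. 1 - expect_input d (f d)) \<and>
               exp_small (\<lambda>d. expect_output S A d (f d)))) \<and>
         (\<forall>\<delta> :: nat \<Rightarrow> real. infeasible_or_nonmono_with_prob S A \<delta> \<longrightarrow>
            (\<exists>f :: nat \<Rightarrow> point \<Rightarrow> bool.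
               exp_small (\<lambda>d. 1 - expect_input d (f d)) \<and>
               exp_small (\<lambda>d. expect_output S A d (f d) - 2 * \<delta> d)))"
proof -
  have input: "exp_small (\<lambda>d. 1 - expect_input d (high_set d))"
    by (rule exp_small_mono[OF exp_small_powr[OF tail_rate_pos] expect_input_high_set])
  have "exp_small (\<lambda>d. q d * 2 powr (- real d / 64))"
    using exp_small_subexponential[OF assms(3), of "1 / 64"] by simp
  then have bound: "exp_small (\<lambda>d. 2 powr (- tail_rate * d) +
      (q d * 2 powr (- real d / 64) + q d * 2 powr (- real d / 64)))"
    by (intro exp_small_add exp_small_powr tail_rate_pos)
  have out: "exp_small (\<lambda>d. expect_output S A d (high_set d) - 2 * \<delta> d)"
    if "infeasible_or_nonmono_with_prob S A \<delta>" for \<delta>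
  proof (rule exp_small_mono[OF bound])
    fix d
    show "expect_output S A d (high_set d) - 2 * \<delta> d \<le> 2 powr (- tail_rate * d) +
        (q d * 2 powr (- real d / 64) + q d * 2 powr (- real d / 64))"
      using expect_output_high_set_le[OF assms(1) that, of d "q d"] length_calls_le[OF assms(2)[of d]]
      by (simp only: diff_le_eq add.commute[of _ "2 * \<delta> d"])
  qed
  show ?thesis
    using input out out[OF infeasible_or_nonmono_with_prob_0[OF assms(1)]] by auto
qed

end
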